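(* For $k,n\in\mathbb{N}$, let $\ell(k,n)$ denote the (least) period of the sequence $(S_n(m)\bmod k)_{m\ge 1}$, where $S_n(m)=\sum_{i=1}^m i^n$. Then: (1) $\ell(2,n)=4$ for all $n\in\mathbb{N}$. (2) For $a\ge 2$, $\ell(2^a,n)=2^{a+1}$ if $n=1$ or $2\mid n$, and $\ell(2^a,n)=2^a$ otherwise. (3) For $q$ an odd prime and $a\ge 1$, $$\ell(q^a,n)=\begin{cases} q^{a+1}, & \text{if } q-1\mid n;\\ q^{a-i}, & \text{if } q-1\nmid n,\ \nu_q(n)=i,\ 0\le i\le a-2;\\ q, & \text{if } q-1\nmid n \text{ and } q^{a-1}\mid n,\end{cases}$$ where $\nu_q(n)$ is the exponent of the highest power of $q$ dividing $n$.
   Context: $\mathbb{N}$ denotes the positive integers. $S_n(m)=1^n+2^n+\dots+m^n$. The sequence $(S_n(m)\bmod k)_{m\ge1}$ is periodic (for every $k,n$), and $\ell(k,n)$ is its least period. *)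

theory Defs
  imports "HOL-Number_Theory.Number_Theory"
begin

definition power_sum :: "nat \<Rightarrow> nat \<Rightarrow> nat" where
  "power_sum n m = (\<Sum>i=1..m. i ^ n)"

text \<open>Sequences are indexed from 1; the value at 0 plays no role.\<close>

definition is_period :: "(nat \<Rightarrow> 'a) \<Rightarrow> nat \<Rightarrow> bool" where
  "is_period f p \<longleftrightarrow> p \<ge> 1 \<and> (\<forall>m\<ge>1. f (m + p) = f m)"

definition least_period :: "(nat \<Rightarrow> 'a) \<Rightarrow> nat" where
  "least_period f = (LEAST p. is_period f p)"

definition ell :: "nat \<Rightarrow> nat \<Rightarrow> nat" where
  "ell k n = least_period (\<lambda>m. power_sum n m mod k)"

lemma power_sum_Suc: "power_sum n (Suc m) = power_sum n m + Suc m ^ n"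
  by (simp add: power_sum_def)

lemma power_sum_add_modulus:
  "[power_sum n (m + k) = power_sum n m + power_sum n k] (mod k)"
proof (induction m)
  case 0
  show ?case by (simp add: power_sum_def)
next
  case (Suc m)
  have "[Suc (m + k) = Suc m] (mod k)"
    by (simp add: cong_def flip: add_Suc)
  then have "[Suc (m + k) ^ n = Suc m ^ n] (mod k)"
    by (rule cong_pow)
  from cong_add[OF Suc this] show ?case
    by (simp add: power_sum_Suc ac_simps)
qed

lemma power_sum_add_mult_modulus:
  "[power_sum n (m + j * k) = power_sum n m + j * power_sum n k] (mod k)"
proof (induction j)
  case 0
  show ?case by simp
next
  case (Suc j)
  have "[power_sum n (m + j * k + k) = power_sum n (m + j * k) + power_sum n k] (mod k)"
    by (rule power_sum_add_modulus)
  also have "[power_sum n (m + j * k) + power_sum n k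
      = power_sum n m + j * power_sum n k + power_sum n k] (mod k)"
    using Suc by (intro cong_add cong_refl)
  finally show ?case by (simp add: ac_simps)
qed

text \<open>A period exists, so the least period is well defined.\<close>

lemma is_period_power_sum:
  assumes "k \<ge> 1"
  shows "is_period (\<lambda>m. power_sum n m mod k) (k * k)"
  using assms power_sum_add_mult_modulus[of n _ k k]
  by (simp add: is_period_def cong_def)

lemma is_period_ell:
  assumes "k \<ge> 1"
  shows "is_period (\<lambda>m. power_sum n m mod k) (ell k n)"
  unfolding ell_def least_period_def
  by (rule LeastI, rule is_period_power_sum, rule assms)

end

theory Submission
  imports Defs
begin

text \<open>
  Write \<open>S\<close> for \<open>power_sum n\<close>. Taking differences, \<open>p\<close> is a period of \<open>S\<close> modulo \<open>k\<close> iff \<open>p\<close> is a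
  period of \<open>x ^ n\<close> modulo \<open>k\<close> and \<open>k\<close> divides \<open>S p\<close>. For \<open>k = q ^ a\<close> the least period divides a power
  of \<open>q\<close>, so it equals \<open>q ^ (j + 1)\<close> once \<open>q ^ (j + 1)\<close> is a period and \<open>q ^ j\<close> is not.

  If \<open>q - 1\<close> divides \<open>n\<close> (with \<open>n\<close> even when \<open>q = 2\<close>), expanding \<open>(x + t N) ^ n\<close> modulo \<open>N\<^sup>2\<close> gives
  \<open>S (q N) \<equiv> q S N\<close> modulo \<open>q N\<close> for \<open>N = q ^ j\<close>, hence \<open>S (q ^ a) \<equiv> q ^ (a - 1) S q\<close> modulo \<open>q ^ a\<close>, while
  \<open>S q \<equiv> -1\<close> modulo \<open>q\<close> by Fermat: \<open>q ^ a\<close> just fails to be a period. Otherwise, for odd \<open>q\<close>, a primitive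
  root \<open>g\<close> permutes the residues modulo a period \<open>q ^ s\<close> of \<open>x ^ n\<close>, so \<open>(g ^ n - 1) S (q ^ s) \<equiv> 0\<close> with
  \<open>g ^ n - 1\<close> invertible; thus only the period of \<open>x ^ n\<close> matters, and it is detected at \<open>x = 1\<close>.
\<close>

section \<open>Periods and least periods of arbitrary sequences\<close>

lemma is_period_mult:
  assumes "is_period f p" "j \<ge> 1"
  shows "is_period f (j * p)"
proof -
  have "f (m + j * p) = f m" if "m \<ge> 1" for m
  proof (induction j)
    case (Suc j)
    have "f (m + j * p + p) = f (m + j * p)"
      using assms(1) that by (simp add: is_period_def)
    with Suc show ?case by (simp add: ac_simps)
  qed simp
  with assms show ?thesis by (simp add: is_period_def)
qed

lemma least_period_dvd:
  assumes "is_period f p"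
  shows "least_period f dvd p"
proof (rule ccontr)
  define d where "d = least_period f"
  define r where "r = p mod d"
  assume "\<not> least_period f dvd p"
  then have r: "r \<ge> 1"
    by (simp add: r_def d_def dvd_eq_mod_eq_0 Suc_le_eq)
  have d: "is_period f d"
    unfolding d_def least_period_def using assms by (rule LeastI)
  have "r < d"
    using d by (simp add: r_def is_period_def)
  have "f (m + r) = f m" if m: "m \<ge> 1" for m
  proof -
    have "f (m + r + p div d * d) = f (m + r)"
    proof (cases "p div d = 0")
      case False
      then have "is_period f (p div d * d)"
        using d by (intro is_period_mult) auto
      then show ?thesis using m by (simp add: is_period_def)
    qed simp
    moreover have "m + r + p div d * d = m + p"
      by (simp add: r_def)
    ultimately show ?thesis
      using assms m by (simp add: is_period_def)
  qed
  with r have "is_period f r" by (simp add: is_period_def)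
  then have "d \<le> r"
    unfolding d_def least_period_def by (rule Least_le)
  with \<open>r < d\<close> show False by simp
qed

text \<open>The least period is \<open>q ^ t\<close> with \<open>t \<le> Suc j\<close>; if
  \<open>t \<le> j\<close>, then \<open>q ^ j\<close> would be a multiple of it and hence a
  period.\<close>

lemma least_period_prime_power:
  fixes q :: nat
  assumes "prime q" and per: "is_period f (q ^ Suc j)" and nper: "\<not> is_period f (q ^ j)"
  shows "least_period f = q ^ Suc j"
proof -
  obtain t where t: "t \<le> Suc j" "least_period f = q ^ t"
    using least_period_dvd[OF per] unfolding divides_primepow_nat[OF \<open>prime q\<close>] by blast
  have lp: "is_period f (least_period f)"
    unfolding least_period_def using per by (rule LeastI)
  have "t = Suc j"
  proof (rule ccontr)
    assume "t \<noteq> Suc j"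
    with t(1) have "q ^ (j - t) * q ^ t = q ^ j"
      by (simp flip: power_add)
    moreover have "q ^ (j - t) \<ge> 1"
      using \<open>prime q\<close> by (simp add: prime_gt_0_nat Suc_le_eq)
    ultimately show False
      using nper is_period_mult[OF lp] t(2) by metis
  qed
  with t show ?thesis by simp
qed

section \<open>Periods of power sums through differences\<close>

lemma power_sum_add:
  "power_sum n (m + p) = power_sum n p + (\<Sum>x=1..m. (x + p) ^ n)"
  by (induction m) (simp_all add: power_sum_def)

lemma is_period_power_sum_iff:
  assumes "k \<ge> 1"
  shows "is_period (\<lambda>m. power_sum n m mod k) p \<longleftrightarrow>
    p \<ge> 1 \<and> (\<forall>x\<ge>1. [(x + p) ^ n = x ^ n] (mod k)) \<and> k dvd power_sum n p"
proof (intro iffI conjI)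
  assume per: "is_period (\<lambda>m. power_sum n m mod k) p"
  then show "p \<ge> 1" by (simp add: is_period_def)
  have S: "[power_sum n (m + p) = power_sum n m] (mod k)" if "m \<ge> 1" for m
    using per that by (simp add: is_period_def cong_def)
  \<comment> \<open>Differencing reaches only \<open>x \<ge> 2\<close>, because periodicity is
    assumed from index 1 on.\<close>
  have pow2: "[(x + p) ^ n = x ^ n] (mod k)" if "x \<ge> 2" for x
  proof -
    obtain m where m: "x = Suc m" "m \<ge> 1"
      using \<open>x \<ge> 2\<close> by (cases x) auto
    have "[power_sum n (m + p) + (x + p) ^ n = power_sum n m + x ^ n] (mod k)"
      using S[of x] m by (simp add: power_sum_Suc)
    moreover have "[power_sum n (m + p) + (x + p) ^ n = power_sum n m + (x + p) ^ n] (mod k)"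
      using S[OF m(2)] by (intro cong_add cong_refl)
    ultimately have "[power_sum n m + (x + p) ^ n = power_sum n m + x ^ n] (mod k)"
      using cong_trans cong_sym by blast
    then show ?thesis by (simp add: cong_add_lcancel_nat)
  qed
  \<comment> \<open>The case \<open>x = 1\<close> follows after shifting \<open>x\<close> by
    \<open>k\<close>, which changes no power modulo \<open>k\<close>.\<close>
  have pow: "[(x + p) ^ n = x ^ n] (mod k)" if "x \<ge> 1" for x
  proof -
    have "[(x + p) ^ n = (x + k + p) ^ n] (mod k)"
      by (intro cong_pow) (simp add: cong_def add.commute add.left_commute)
    also have "[(x + k + p) ^ n = (x + k) ^ n] (mod k)"
      using that assms by (intro pow2) simp
    also have "[(x + k) ^ n = x ^ n] (mod k)"
      by (intro cong_pow) (simp add: cong_def)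
    finally show ?thesis .
  qed
  then show "\<forall>x\<ge>1. [(x + p) ^ n = x ^ n] (mod k)" by blast
  have "[power_sum n p + (1 + p) ^ n = 0 + 1] (mod k)"
    using S[of 1] by (simp add: power_sum_def)
  moreover have "[power_sum n p + (1 + p) ^ n = power_sum n p + 1] (mod k)"
    using pow[of 1] by (intro cong_add cong_refl) simp
  ultimately have "[power_sum n p + 1 = 0 + 1] (mod k)"
    using cong_trans cong_sym by blast
  then have "[power_sum n p = 0] (mod k)"
    by (simp only: cong_add_rcancel_nat)
  then show "k dvd power_sum n p" by (simp add: cong_0_iff)
next
  assume *: "p \<ge> 1 \<and> (\<forall>x\<ge>1. [(x + p) ^ n = x ^ n] (mod k)) \<and> k dvd power_sum n p"
  have "[power_sum n (m + p) = power_sum n m] (mod k)" for m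
  proof -
    have "[power_sum n p + (\<Sum>x=1..m. (x + p) ^ n) = 0 + (\<Sum>x=1..m. x ^ n)] (mod k)"
      using * by (intro cong_add cong_sum) (auto simp: cong_0_iff)
    then show ?thesis by (simp add: power_sum_add) (simp add: power_sum_def)
  qed
  with * show "is_period (\<lambda>m. power_sum n m mod k) p"
    by (simp add: is_period_def cong_def)
qed

section \<open>First-order expansion and power sums over blocks\<close>

lemma power_add_cong_square:
  fixes x c :: nat
  shows "[(x + c) ^ Suc n = x ^ Suc n + Suc n * c * x ^ n] (mod c\<^sup>2)"
proof (induction n)
  case 0
  show ?case by simp
next
  case (Suc n)
  have "[(x + c) * (x + c) ^ Suc n = (x + c) * (x ^ Suc n + Suc n * c * x ^ n)] (mod c\<^sup>2)"
    using Suc by (intro cong_mult cong_refl)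
  also have "(x + c) * (x ^ Suc n + Suc n * c * x ^ n)
      = x ^ Suc (Suc n) + Suc (Suc n) * c * x ^ Suc n + c\<^sup>2 * (Suc n * x ^ n)"
    by (simp add: algebra_simps power2_eq_square)
  also have "[\<dots> = x ^ Suc (Suc n) + Suc (Suc n) * c * x ^ Suc n + 0] (mod c\<^sup>2)"
    by (intro cong_add cong_refl) (simp add: cong_0_iff)
  finally show ?case by simp
qed

lemma power_sum_mult:
  "power_sum n (q * N) = (\<Sum>t<q. \<Sum>x=1..N. (x + t * N) ^ n)"
proof (induction q)
  case 0
  show ?case by (simp add: power_sum_def)
next
  case (Suc q)
  then show ?case
    using power_sum_add[of n N "q * N"] by simp
qed

text \<open>In the block starting after \<open>t * N\<close>, expand to first order: the quadratic
  terms vanish since \<open>q\<close> divides \<open>N\<close>, and the linear terms add up to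
  \<open>N\<close> times the number in the second hypothesis.\<close>

lemma power_sum_mult_cong:
  assumes "q dvd N" and "q dvd Suc n * (\<Sum>t<q. t) * power_sum n N"
  shows "[power_sum (Suc n) (q * N) = q * power_sum (Suc n) N] (mod q * N)"
proof -
  have step: "[(x + t * N) ^ Suc n = x ^ Suc n + Suc n * (t * N) * x ^ n] (mod q * N)" for x t
  proof (rule cong_dvd_modulus_nat[OF power_add_cong_square])
    show "q * N dvd (t * N)\<^sup>2"
      unfolding power2_eq_square using assms(1) by (intro mult_dvd_mono dvd_mult) simp_all
  qed
  have "[power_sum (Suc n) (q * N)
      = (\<Sum>t<q. \<Sum>x=1..N. x ^ Suc n + Suc n * (t * N) * x ^ n)] (mod q * N)"
    unfolding power_sum_mult by (intro cong_sum step)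
  also have "(\<Sum>t<q. \<Sum>x=1..N. x ^ Suc n + Suc n * (t * N) * x ^ n)
      = q * power_sum (Suc n) N + N * (Suc n * (\<Sum>t<q. t) * power_sum n N)"
    unfolding sum.distrib power_sum_def
    by (simp add: sum_distrib_left sum_distrib_right mult_ac del: power_Suc mult_Suc mult_Suc_right)
       (rule sum.swap)
  also have "[\<dots> = q * power_sum (Suc n) N + 0] (mod q * N)"
    using assms(2) by (intro cong_add cong_refl) (simp add: cong_0_iff mult.commute[of q])
  finally show ?thesis by simp
qed

lemma dvd_sum_lessThan_odd:
  fixes q :: nat
  assumes "odd q"
  shows "q dvd (\<Sum>t<q. t)"
proof -
  obtain h where "q = Suc (2 * h)" using assms by (auto elim: oddE)
  have "(\<Sum>t<Suc (2 * h). t) = Suc (2 * h) * h" for h :: nat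
    by (induction h) (simp_all add: algebra_simps)
  from this[of h] \<open>q = _\<close> show ?thesis by (simp only: dvd_triv_left)
qed

section \<open>Lifting congruences of powers\<close>

text \<open>The cofactor of \<open>x - y\<close> in \<open>x ^ q - y ^ q\<close> has
  \<open>q\<close> terms, all congruent to \<open>y ^ (q - 1)\<close> modulo \<open>q\<close>, so it
  supplies the extra factor \<open>q\<close>.\<close>

lemma cong_prime_power_lift:
  fixes x y :: int
  assumes "[x = y] (mod int q ^ Suc s)"
  shows "[x ^ q = y ^ q] (mod int q ^ Suc (Suc s))"
proof -
  have "[x = y] (mod int q)"
    using assms by (rule cong_dvd_modulus) simp
  then have "[(\<Sum>i<q. y ^ (q - Suc i) * x ^ i) = (\<Sum>i<q. y ^ (q - Suc i) * y ^ i)] (mod int q)"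
    by (intro cong_sum cong_mult cong_pow cong_refl)
  also have "(\<Sum>i<q. y ^ (q - Suc i) * y ^ i) = (\<Sum>i<q. y ^ (q - 1))"
    by (intro sum.cong refl) (simp flip: power_add)
  also have "[\<dots> = 0] (mod int q)"
    by (simp add: cong_0_iff)
  finally have "int q dvd (\<Sum>i<q. y ^ (q - Suc i) * x ^ i)"
    by (simp add: cong_0_iff)
  moreover have "int q ^ Suc s dvd x - y"
    using assms by (simp add: cong_iff_dvd_diff)
  ultimately have "int q ^ Suc s * int q dvd x ^ q - y ^ q"
    unfolding power_diff_sumr2 by (intro mult_dvd_mono)
  then show ?thesis by (simp add: cong_iff_dvd_diff mult.commute)
qed

lemma cong_power_prime_power_lift:
  fixes x y :: int
  assumes "[x = y] (mod int q ^ Suc s)"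
  shows "[x ^ (q ^ i) = y ^ (q ^ i)] (mod int q ^ Suc (s + i))"
proof (induction i)
  case (Suc i)
  from cong_prime_power_lift[OF this] show ?case
    by (simp flip: power_mult add: mult.commute)
qed (use assms in simp)

lemma cong_power_lift:
  fixes x y :: nat
  assumes "[x = y] (mod q ^ Suc s)" "q ^ i dvd n"
  shows "[x ^ n = y ^ n] (mod q ^ Suc (s + i))"
proof -
  obtain r where n: "n = q ^ i * r" using assms(2) by blast
  have "[int x = int y] (mod int q ^ Suc s)"
    using assms(1) by (simp flip: cong_int_iff)
  then have "[(int x ^ (q ^ i)) ^ r = (int y ^ (q ^ i)) ^ r] (mod int q ^ Suc (s + i))"
    by (intro cong_pow cong_power_prime_power_lift)
  then show ?thesis
    by (simp add: n power_mult flip: cong_int_iff)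
qed

text \<open>Each \<open>q\<close>-th power raises the leading deviation from 1 by exactly one factor
  \<open>q\<close>. This sharpness later shows that candidates fail to be periods.\<close>

lemma one_plus_power_prime_power:
  assumes "odd q"
  shows "[(1 + q ^ Suc s) ^ (q ^ i) = 1 + q ^ Suc (s + i)] (mod q ^ Suc (Suc (s + i)))"
proof (induction i)
  case 0
  show ?case by simp
next
  case (Suc i)
  define T where "T = s + i"
  define c where "c = q ^ Suc T"
  have "[((1 + q ^ Suc s) ^ (q ^ i)) ^ q = (1 + c) ^ q] (mod q ^ Suc (Suc T + 1))"
    using Suc by (intro cong_power_lift) (simp_all add: T_def c_def)
  moreover have "[(1 + c) ^ q = 1 + q ^ Suc (Suc T)] (mod q ^ Suc (Suc (Suc T)))"
  proof -
    have q2: "q\<^sup>2 dvd c\<^sup>2" by (simp add: c_def)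
    have pw: "[(1 + c) ^ j = 1 + j * c] (mod q\<^sup>2)" for j
    proof (cases j)
      case (Suc m)
      show ?thesis
        using cong_dvd_modulus_nat[OF power_add_cong_square[of 1 c m] q2] Suc by simp
    qed simp
    \<comment> \<open>This geometric sum times \<open>c\<close> is \<open>(1 + c) ^ q - 1\<close>.
      It is \<open>q\<close> modulo \<open>q\<^sup>2\<close>, because \<open>q\<close> divides both
      \<open>c\<close> and, being odd, the sum of all \<open>j < q\<close>.\<close>
    have "[(\<Sum>j<q. (1 + c) ^ j) = (\<Sum>j<q. 1 + j * c)] (mod q\<^sup>2)"
      by (intro cong_sum pw)
    also have "(\<Sum>j<q. 1 + j * c) = q + (\<Sum>j<q. j) * c"
      by (simp only: sum.distrib sum_distrib_right) simp
    also have "[\<dots> = q + 0] (mod q\<^sup>2)"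
      using mult_dvd_mono[OF dvd_sum_lessThan_odd[OF assms], of q c]
      by (intro cong_add cong_refl) (simp add: cong_0_iff power2_eq_square c_def)
    finally have "[c * (\<Sum>j<q. (1 + c) ^ j) = c * q] (mod c * q\<^sup>2)"
      by (simp add: cong_def flip: mult_mod_right)
    then have "[1 + c * (\<Sum>j<q. (1 + c) ^ j) = 1 + c * q] (mod c * q\<^sup>2)"
      by (intro cong_add cong_refl)
    moreover have "1 + c * (\<Sum>j<m. (1 + c) ^ j) = (1 + c) ^ m" for m
      by (induction m) (simp_all add: algebra_simps)
    ultimately show ?thesis
      by (simp add: c_def power2_eq_square mult_ac)
  qed
  ultimately show ?case
    by (simp add: T_def cong_def mult.commute flip: power_mult)
qed

lemma one_plus_power_not_cong_1:
  fixes q r :: nat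
  assumes "prime q" "\<not> q dvd r"
  shows "\<not> [(1 + q ^ Suc T) ^ r = 1] (mod q ^ Suc (Suc T))"
proof
  assume 1: "[(1 + q ^ Suc T) ^ r = 1] (mod q ^ Suc (Suc T))"
  obtain m where m: "r = Suc m" using assms(2) by (cases r) auto
  have "q ^ Suc (Suc T) dvd (q ^ Suc T)\<^sup>2"
    unfolding power_mult[symmetric] by (rule le_imp_power_dvd) simp
  from cong_dvd_modulus_nat[OF power_add_cong_square[of 1 "q ^ Suc T" m] this]
  have "[(1 + q ^ Suc T) ^ r = 1 + r * q ^ Suc T] (mod q ^ Suc (Suc T))"
    by (simp add: m)
  with 1 have "[r * q ^ Suc T + 1 = 0 + 1] (mod q ^ Suc (Suc T))"
    by (simp add: cong_def)
  then have "q ^ Suc (Suc T) dvd r * q ^ Suc T"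
    unfolding cong_add_rcancel_nat by (simp add: cong_0_iff)
  then have "q dvd r"
    using \<open>prime q\<close> by (simp add: prime_gt_0_nat)
  with assms show False by simp
qed

section \<open>Power sums at prime powers\<close>

text \<open>By \<open>dep\<close>, \<open>x ^ n\<close> modulo \<open>q ^ a\<close> is a function of
  the residue of \<open>x\<close> modulo \<open>q ^ Suc s\<close>, so the sum may be reindexed by
  multiplication with a primitive root.\<close>

lemma dvd_power_sum_prime_power:
  fixes q n :: nat
  assumes q: "prime q" and nd: "\<not> (q - 1) dvd n" and n: "n \<ge> 1"
    and dep: "\<And>x y. [x = y] (mod q ^ Suc s) \<Longrightarrow> [x ^ n = y ^ n] (mod q ^ a)"
  shows "q ^ a dvd power_sum n (q ^ Suc s)"
proof -
  define N where "N = q ^ Suc s"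
  define k where "k = q ^ a"
  note dep = dep[folded k_def]
  have N: "N > 0" using q by (simp add: N_def prime_gt_0_nat)
  obtain g where g: "residue_primroot q g"
    using prime_primitive_root_exists[of q] q prime_gt_1_nat[of q] by auto
  have cop: "coprime g q" and og: "ord q g = q - 1"
    using g q by (auto simp: residue_primroot_def totient_prime coprime_commute)
  have gn: "\<not> [g ^ n = 1] (mod q)"
    using nd unfolding ord_divides og .
  \<comment> \<open>The range from 0 fits the residues returned by \<open>mod N\<close>; the end
    term \<open>N ^ n\<close> is congruent to \<open>0 ^ n\<close> and restored last.\<close>
  define S where "S = (\<Sum>x<N. x ^ n)"
  have inj: "inj_on (\<lambda>x. g * x mod N) {..<N}"
  proof (rule inj_onI)
    fix x y assume "x \<in> {..<N}" "y \<in> {..<N}" "g * x mod N = g * y mod N"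
    moreover have "coprime g N" using cop by (simp add: N_def)
    ultimately show "x = y"
      by (simp add: cong_mult_lcancel_nat cong_less_modulus_unique_nat flip: cong_def)
  qed
  have img: "(\<lambda>x. g * x mod N) ` {..<N} = {..<N}"
    using N by (intro endo_inj_surj inj) auto
  have "S = (\<Sum>x<N. (g * x mod N) ^ n)"
    unfolding S_def using sum.reindex[OF inj, of "\<lambda>x. x ^ n"] img by simp
  also have "[\<dots> = (\<Sum>x<N. (g * x) ^ n)] (mod k)"
    by (intro cong_sum dep) (simp add: N_def cong_def)
  also have "(\<Sum>x<N. (g * x) ^ n) = g ^ n * S"
    by (simp add: S_def power_mult_distrib sum_distrib_left)
  finally have "[int (g ^ n * S) = int S] (mod int k)"
    by (simp only: cong_int_iff cong_sym_eq)
  then have "int k dvd (int g ^ n - 1) * int S"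
    by (simp add: cong_iff_dvd_diff algebra_simps)
  moreover have "\<not> int q dvd int g ^ n - 1"
    using gn by (metis cong_iff_dvd_diff cong_int_iff of_nat_1 of_nat_power)
  then have "coprime (int q) (int g ^ n - 1)"
    using q by (intro prime_imp_coprime) auto
  then have "coprime (int k) (int g ^ n - 1)"
    by (simp add: k_def)
  ultimately have "int k dvd int S"
    by (simp add: coprime_dvd_mult_right_iff)
  then have S: "k dvd S" by simp
  have "[N ^ n = 0 ^ n] (mod k)"
    by (rule dep) (simp add: N_def cong_def)
  then have "k dvd N ^ n" using n by (simp add: cong_0_iff power_0_left)
  moreover have "power_sum n m = (\<Sum>x<m. x ^ n) + m ^ n" for m
    using n by (induction m) (auto simp: power_sum_def power_0_left)
  ultimately show ?thesis using S by (simp add: S_def N_def k_def)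
qed

text \<open>By Fermat the first \<open>q - 1\<close> terms are 1 modulo \<open>q\<close> and the
  last is 0.\<close>

lemma power_sum_prime_not_dvd:
  fixes q n :: nat
  assumes q: "prime q" and d: "(q - 1) dvd n" and n: "n \<ge> 1"
  shows "\<not> q dvd power_sum n q"
proof -
  obtain p where p: "q = Suc p" "p > 0" using prime_gt_1_nat[OF q] by (cases q) auto
  have "[x ^ n = 1] (mod q)" if "x \<in> {1..p}" for x
  proof -
    obtain r where r: "n = (q - 1) * r" using d by blast
    have "\<not> q dvd x" using that p by (auto dest: dvd_imp_le)
    from cong_pow[OF fermat_theorem[OF q this], of r] show ?thesis
      by (simp add: r power_mult)
  qed
  then have "[(\<Sum>x=1..p. x ^ n) = (\<Sum>x=1..p. 1)] (mod q)"
    by (intro cong_sum) simp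
  then have "[(\<Sum>x=1..p. x ^ n) + q ^ n = (\<Sum>x=1..p. 1) + 0] (mod q)"
    using n by (intro cong_add) (simp_all add: cong_0_iff)
  then have "[power_sum n q = p] (mod q)"
    by (simp add: power_sum_def p)
  then show ?thesis
    using p by (auto simp: cong_dvd_iff dest: dvd_imp_le)
qed

text \<open>Iterates \<open>power_sum_mult_cong\<close>. The divisibility hypothesis covers odd
  \<open>q\<close>, which divides the sum of the \<open>t\<close>, and \<open>q = 2\<close> with
  even \<open>n\<close>, where that sum is 1.\<close>

lemma power_sum_prime_power_cong:
  fixes q n :: nat
  assumes n: "n \<ge> 1" and "q dvd n * (\<Sum>t<q. t)"
  shows "[power_sum n (q ^ Suc j) = q ^ j * power_sum n q] (mod q ^ Suc j)"
proof (induction j)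
  case 0
  show ?case by simp
next
  case (Suc j)
  obtain m where m: "n = Suc m" using n by (cases n) auto
  have "[power_sum n (q * q ^ Suc j) = q * power_sum n (q ^ Suc j)] (mod q * q ^ Suc j)"
    unfolding m by (rule power_sum_mult_cong) (use assms(2) m in auto)
  also have "[q * power_sum n (q ^ Suc j) = q * (q ^ j * power_sum n q)] (mod q * q ^ Suc j)"
    using Suc unfolding cong_def by (simp only: flip: mult_mod_right)
  finally show ?case by (simp add: mult.assoc)
qed

section \<open>The cases where the least period exceeds the modulus\<close>

text \<open>The modulus is a period of \<open>x ^ n\<close> but does not divide its power sum, which
  lacks one factor \<open>q\<close>; \<open>q\<close> blocks supply it. Leaving \<open>u\<close>
  general admits \<open>q = 2\<close>, \<open>n = 1\<close> as well.\<close>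

lemma ell_eq_mult_prime:
  fixes q n :: nat
  assumes q: "prime q" and c: "[power_sum n (q ^ Suc j) = q ^ j * u] (mod q ^ Suc j)"
    and u: "\<not> q dvd u"
  shows "ell (q ^ Suc j) n = q ^ Suc (Suc j)"
  unfolding ell_def
proof (rule least_period_prime_power[OF q])
  let ?k = "q ^ Suc j"
  have k: "?k \<ge> 1" using q by (simp add: prime_gt_0_nat Suc_le_eq)
  have "\<not> ?k dvd power_sum n ?k"
    using u q by (simp add: cong_dvd_iff[OF c] mult.commute[of q] prime_gt_0_nat del: power_Suc)
       (simp add: prime_gt_0_nat)
  then show "\<not> is_period (\<lambda>m. power_sum n m mod ?k) ?k"
    using k by (simp add: is_period_power_sum_iff)
  have "[power_sum n (0 + q * ?k) = power_sum n 0 + q * power_sum n ?k] (mod ?k)"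
    by (rule power_sum_add_mult_modulus)
  also have "[power_sum n 0 + q * power_sum n ?k = 0 + q * (q ^ j * u)] (mod ?k)"
    by (intro cong_add cong_mult c cong_refl) (simp add: power_sum_def)
  also have "[0 + q * (q ^ j * u) = 0] (mod ?k)"
    by (simp add: cong_0_iff)
  finally have "?k dvd power_sum n (q ^ Suc (Suc j))"
    by (simp add: cong_0_iff)
  moreover have "[(x + q ^ Suc (Suc j)) ^ n = x ^ n] (mod ?k)" for x
    by (intro cong_pow) (simp add: cong_iff_dvd_diff cong_def)
  moreover have "q ^ Suc (Suc j) \<ge> 1" using q by (simp add: prime_gt_0_nat Suc_le_eq)
  ultimately show "is_period (\<lambda>m. power_sum n m mod ?k) (q ^ Suc (Suc j))"
    using k by (simp add: is_period_power_sum_iff)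
qed

lemma ell_prime_power_dvd:
  fixes q n :: nat
  assumes q: "prime q" and d: "(q - 1) dvd n" and n: "n \<ge> 1" and "q dvd n * (\<Sum>t<q. t)"
    and a: "a \<ge> 1"
  shows "ell (q ^ a) n = q ^ (a + 1)"
proof -
  obtain j where "a = Suc j" using a by (cases a) auto
  then show ?thesis
    using ell_eq_mult_prime[OF q power_sum_prime_power_cong[OF n assms(4)]
      power_sum_prime_not_dvd[OF q d n]] by simp
qed

lemma ell_2:
  assumes "n \<ge> 1"
  shows "ell 2 n = 4"
proof -
  have "\<not> 2 dvd power_sum n 2"
    using assms by (intro power_sum_prime_not_dvd) auto
  then show ?thesis
    using ell_eq_mult_prime[of 2 n 0 "power_sum n 2"] by simp
qed

lemma ell_two_power_1:
  assumes "a \<ge> 1"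
  shows "ell (2 ^ a) 1 = 2 ^ (a + 1)"
proof -
  obtain j where j: "a = Suc j" using assms by (cases a) auto
  have "2 * power_sum 1 m = m * (m + 1)" for m
    by (induction m) (simp_all add: power_sum_def)
  from this[of "2 ^ Suc j"] have "power_sum 1 (2 ^ Suc j) = 2 ^ j * (2 ^ Suc j + 1)"
    by simp
  with ell_eq_mult_prime[of 2 1 j "2 ^ Suc j + 1"] j show ?thesis by simp
qed

section \<open>Odd exponents modulo powers of two\<close>

text \<open>Modulo 2 the sum consists of an even number of equal blocks of length 2. For odd
  exponents this provides the factor 2 that \<open>power_sum_mult_cong\<close> requires.\<close>

lemma even_power_sum_two_power:
  "even (power_sum n (2 ^ Suc (Suc j)))"
proof -
  have "[power_sum n (0 + 2 ^ Suc j * 2) = power_sum n 0 + 2 ^ Suc j * power_sum n 2] (mod 2)"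
    by (rule power_sum_add_mult_modulus)
  then show ?thesis
    by (auto simp: power_sum_def cong_dvd_iff mult.commute dest!: cong_dvd_iff)
qed

lemma dvd_power_sum_two_power:
  assumes "odd n" "n \<noteq> 1"
  shows "2 ^ Suc (Suc j) dvd power_sum n (2 ^ Suc (Suc j))"
proof (induction j)
  case 0
  \<comment> \<open>An odd exponent other than 1 is at least 3, so 4 divides
    \<open>2 ^ n\<close>.\<close>
  obtain m where m: "n = Suc (2 * Suc m)"
    using assms by (metis One_nat_def Suc_eq_plus1 mult_0_right not0_implies_Suc oddE)
  have "[(3::nat) ^ n = 3] (mod 4)"
  proof -
    have "[3 * (3\<^sup>2) ^ Suc m = 3 * 1 ^ Suc m] (mod (4::nat))"
      by (intro cong_mult cong_pow cong_refl) (simp add: cong_def)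
    then show ?thesis by (simp add: m power_mult)
  qed
  moreover have "4 dvd (2::nat) ^ n"
    using le_imp_power_dvd[of 2 n "2::nat"] m by simp
  moreover have "4 dvd (4::nat) ^ n" by (simp add: m)
  ultimately have "[1 + 2 ^ n + 3 ^ n + 4 ^ n = 1 + 0 + 3 + (0::nat)] (mod 4)"
    by (intro cong_add) (simp_all add: cong_0_iff)
  moreover have "power_sum n 4 = 1 + 2 ^ n + 3 ^ n + 4 ^ n"
    by (simp add: power_sum_def eval_nat_numeral)
  ultimately have "[power_sum n 4 = 4] (mod 4)" by simp
  then have "4 dvd power_sum n 4" by (simp add: cong_dvd_iff)
  then show ?case by simp
next
  case (Suc j)
  obtain m where m: "n = Suc m" using assms by (cases n) auto
  let ?N = "2 ^ Suc (Suc j) :: nat"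
  have "[power_sum n (2 * ?N) = 2 * power_sum n ?N] (mod 2 * ?N)"
    unfolding m using even_power_sum_two_power[of m j]
    by (intro power_sum_mult_cong dvd_mult) simp_all
  moreover have "2 * ?N dvd 2 * power_sum n ?N"
    using Suc by (intro mult_dvd_mono) simp_all
  ultimately have "2 * ?N dvd power_sum n (2 * ?N)"
    by (simp only: cong_dvd_iff)
  then show ?case by simp
qed

lemma ell_two_power_odd:
  assumes "odd n" "n \<noteq> 1" "a \<ge> 2"
  shows "ell (2 ^ a) n = 2 ^ a"
proof -
  obtain j where j: "a = Suc (Suc j)"
    using assms(3) by (metis add_2_eq_Suc le_Suc_ex)
  let ?k = "2 ^ Suc (Suc j) :: nat"
  have "ell ?k n = ?k"
    unfolding ell_def
  proof (rule least_period_prime_power)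
    have "[(x + ?k) ^ n = x ^ n] (mod ?k)" for x
      by (intro cong_pow) (simp add: cong_def)
    then show "is_period (\<lambda>m. power_sum n m mod ?k) ?k"
      using dvd_power_sum_two_power[OF assms(1,2)] by (simp add: is_period_power_sum_iff)
    show "\<not> is_period (\<lambda>m. power_sum n m mod ?k) (2 ^ Suc j)"
    proof
      assume "is_period (\<lambda>m. power_sum n m mod ?k) (2 ^ Suc j)"
      then have "[(1 + 2 ^ Suc j) ^ n = 1 ^ n] (mod ?k)"
        by (subst (asm) is_period_power_sum_iff) (simp, blast)
      then show False
        using one_plus_power_not_cong_1[of 2 n j] assms(1) by simp
    qed
  qed simp
  then show ?thesis by (simp add: j)
qed

section \<open>Primes \<open>q\<close> with \<open>q - 1\<close> not dividing
  \<open>n\<close>\<close>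

text \<open>The factor \<open>q ^ i\<close> of \<open>n\<close> lifts congruences by
  \<open>i\<close> powers of \<open>q\<close>; this serves both for the period of
  \<open>x ^ n\<close> and as \<open>dep\<close> in
  \<open>dvd_power_sum_prime_power\<close>.\<close>

lemma is_period_prime_power:
  fixes q n :: nat
  assumes q: "prime q" and "\<not> (q - 1) dvd n" "n \<ge> 1" "q ^ i dvd n"
  shows "is_period (\<lambda>m. power_sum n m mod q ^ Suc (s + i)) (q ^ Suc s)"
proof -
  have "[(x + q ^ Suc s) ^ n = x ^ n] (mod q ^ Suc (s + i))" for x
    by (intro cong_power_lift assms) (simp add: cong_def)
  moreover have "q ^ Suc (s + i) dvd power_sum n (q ^ Suc s)"
    using assms by (intro dvd_power_sum_prime_power cong_power_lift) auto
  moreover have "q ^ Suc s \<ge> 1" "q ^ Suc (s + i) \<ge> 1"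
    using q by (simp_all add: prime_gt_0_nat Suc_le_eq)
  ultimately show ?thesis by (simp add: is_period_power_sum_iff)
qed

lemma ell_prime_power_multiplicity:
  fixes q n :: nat
  assumes q: "prime q" "odd q" and nd: "\<not> (q - 1) dvd n" and n: "n \<ge> 1"
    and i: "multiplicity q n + 2 \<le> a"
  shows "ell (q ^ a) n = q ^ (a - multiplicity q n)"
proof -
  define i where "i = multiplicity q n"
  \<comment> \<open>Chosen so that the claimed period is \<open>q ^ Suc (Suc s)\<close> and the
    candidate to refute, \<open>q ^ Suc s\<close>, is still divisible by \<open>q\<close>.\<close>
  define s where "s = a - i - 2"
  have a: "a = Suc (Suc s + i)" and ai: "a - multiplicity q n = Suc (Suc s)"
    using i by (simp_all add: i_def s_def)
  have "q ^ i dvd n" by (simp add: i_def multiplicity_dvd)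
  then obtain r where r: "n = q ^ i * r" by blast
  have nr: "\<not> q dvd r"
  proof
    assume "q dvd r"
    then have "q ^ Suc i dvd n" by (auto simp: r)
    moreover have "\<not> is_unit q" using q by (simp add: prime_nat_iff)
    ultimately show False
      using n power_dvd_iff_le_multiplicity[of n q "Suc i"] by (simp add: i_def)
  qed
  have "ell (q ^ a) n = q ^ Suc (Suc s)"
    unfolding ell_def a
  proof (rule least_period_prime_power[OF q(1)])
    show "is_period (\<lambda>m. power_sum n m mod q ^ Suc (Suc s + i)) (q ^ Suc (Suc s))"
      by (rule is_period_prime_power) fact+
    show "\<not> is_period (\<lambda>m. power_sum n m mod q ^ Suc (Suc s + i)) (q ^ Suc s)"
    proof
      assume "is_period (\<lambda>m. power_sum n m mod q ^ Suc (Suc s + i)) (q ^ Suc s)"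
      moreover have "q ^ Suc (Suc s + i) \<ge> 1"
        using q by (simp add: prime_gt_0_nat Suc_le_eq)
      ultimately have "[(1 + q ^ Suc s) ^ n = 1] (mod q ^ Suc (Suc (s + i)))"
        by (auto simp: is_period_power_sum_iff dest: spec[of _ 1])
      \<comment> \<open>The \<open>q ^ i\<close>-th power moves the deviation from 1 to exponent
        \<open>Suc (s + i)\<close>, just below the modulus, and \<open>r\<close>, prime to
        \<open>q\<close>, cannot remove it.\<close>
      moreover have "[((1 + q ^ Suc s) ^ (q ^ i)) ^ r = (1 + q ^ Suc (s + i)) ^ r]
          (mod q ^ Suc (Suc (s + i)))"
        by (intro cong_pow one_plus_power_prime_power q)
      ultimately have "[(1 + q ^ Suc (s + i)) ^ r = 1] (mod q ^ Suc (Suc (s + i)))"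
        unfolding r power_mult by (rule cong_trans[OF cong_sym, rotated])
      with one_plus_power_not_cong_1[OF q(1) nr] show False by blast
    qed
  qed
  then show ?thesis by (simp only: ai)
qed

text \<open>Lifting from modulus \<open>q\<close> already reaches \<open>q ^ a\<close>, so only the
  period 1 is left to exclude, and it fails because \<open>power_sum n 1\<close> is 1.\<close>

lemma ell_prime_power_not_dvd:
  fixes q n :: nat
  assumes q: "prime q" and nd: "\<not> (q - 1) dvd n" and n: "n \<ge> 1"
    and a: "a \<ge> 1" and d: "q ^ (a - 1) dvd n"
  shows "ell (q ^ a) n = q"
proof -
  have "ell (q ^ a) n = q ^ Suc 0"
    unfolding ell_def
  proof (rule least_period_prime_power[OF q])
    show "is_period (\<lambda>m. power_sum n m mod q ^ a) (q ^ Suc 0)"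
      using is_period_prime_power[OF q nd n d, of 0] a by simp
    show "\<not> is_period (\<lambda>m. power_sum n m mod q ^ a) (q ^ 0)"
    proof
      assume "is_period (\<lambda>m. power_sum n m mod q ^ a) (q ^ 0)"
      moreover have "q ^ a \<ge> 1" using q by (simp add: prime_gt_0_nat Suc_le_eq)
      ultimately have "q ^ a dvd power_sum n 1"
        by (simp add: is_period_power_sum_iff)
      then show False
        using a prime_gt_1_nat[OF q] by (simp add: power_sum_def)
    qed
  qed
  then show ?thesis by simp
qed

theorem theorem9:
  shows "(\<forall>n\<ge>1. ell 2 n = 4) \<and>
    (\<forall>a\<ge>2. \<forall>n\<ge>1. ell (2 ^ a) n = (if n = 1 \<or> 2 dvd n then 2 ^ (a + 1) else 2 ^ a)) \<and>
    (\<forall>q a n :: nat. prime q \<and> odd q \<and> a \<ge> 1 \<and> n \<ge> 1 \<longrightarrow>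
      ((q - 1) dvd n \<longrightarrow> ell (q ^ a) n = q ^ (a + 1)) \<and>
      (\<forall>i. \<not> ((q - 1) dvd n) \<and> multiplicity q n = i \<and> i + 2 \<le> a \<longrightarrow> ell (q ^ a) n = q ^ (a - i)) \<and>
      (\<not> ((q - 1) dvd n) \<and> q ^ (a - 1) dvd n \<longrightarrow> ell (q ^ a) n = q))"
proof (intro conjI allI impI)
  fix n :: nat assume "n \<ge> 1"
  then show "ell 2 n = 4" by (rule ell_2)
next
  fix a n :: nat assume "a \<ge> 2" "n \<ge> 1"
  then show "ell (2 ^ a) n = (if n = 1 \<or> 2 dvd n then 2 ^ (a + 1) else 2 ^ a)"
    using ell_two_power_1[of a] ell_two_power_odd[of n a] ell_prime_power_dvd[of 2 n a] by auto
next
  fix q a n :: nat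
  assume "prime q \<and> odd q \<and> a \<ge> 1 \<and> n \<ge> 1" "(q - 1) dvd n"
  then show "ell (q ^ a) n = q ^ (a + 1)"
    by (intro ell_prime_power_dvd dvd_mult dvd_sum_lessThan_odd) auto
next
  fix q a n i :: nat
  assume "prime q \<and> odd q \<and> a \<ge> 1 \<and> n \<ge> 1"
    "\<not> ((q - 1) dvd n) \<and> multiplicity q n = i \<and> i + 2 \<le> a"
  then show "ell (q ^ a) n = q ^ (a - i)"
    using ell_prime_power_multiplicity[of q n a] by auto
next
  fix q a n :: nat
  assume "prime q \<and> odd q \<and> a \<ge> 1 \<and> n \<ge> 1" "\<not> ((q - 1) dvd n) \<and> q ^ (a - 1) dvd n"
  then show "ell (q ^ a) n = q"
    by (intro ell_prime_power_not_dvd) auto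
qed

end
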